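(* Let $a,b\in\mathbb{C}$ and let $\mathcal{W}(a,b)$ be the complex Lie algebra with basis $\{L_i,I_j\}_{i,j\in\mathbb{Z}}$ described in the context. If $b\neq-1$, then there are no non-trivial $\frac12$-derivations of $\mathcal{W}(a,b)$. If $b=-1$ and $\varphi$ is a $\frac12$-derivation of $\mathcal{W}(a,-1)$, then there are two families $\{\alpha_t\}_{t\in\mathbb{Z}}$ and $\{\beta_t\}_{t\in\mathbb{Z}}$ of complex numbers, each with only finitely many nonzero members, such that for all $m\in\mathbb{Z}$ $$\varphi(L_m)=\sum_{t\in\mathbb{Z}}\alpha_tL_{m+t}+\sum_{t\in\mathbb{Z}}\beta_tI_{m+t},\qquad \varphi(I_m)=\sum_{t\in\mathbb{Z}}\alpha_tI_{m+t}.$$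
   Context: The Lie algebra $\mathcal{W}(a,b)$ has basis $\{L_i,I_j\}_{i,j\in\mathbb{Z}}$ and brackets $[L_m,L_n]=(m-n)L_{m+n}$, $[L_m,I_n]=-(n+a+bm)I_{m+n}$, $[I_m,I_n]=0$. A $\frac12$-derivation of a Lie algebra $\mathfrak{L}$ is a linear map $\varphi:\mathfrak{L}\to\mathfrak{L}$ with $\varphi([x,y])=\frac12\left([\varphi(x),y]+[x,\varphi(y)]\right)$ for all $x,y$; it is trivial if it is multiplication by a scalar in $\mathbb{C}$. *)

theory Defs
  imports Complex_Main "HOL-Library.Poly_Mapping"
begin

locale complex_lie_algebra = vector_space scale
  for scale :: "complex \<Rightarrow> 'v::ab_group_add \<Rightarrow> 'v" +
  fixes bracket :: "'v \<Rightarrow> 'v \<Rightarrow> 'v"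
  assumes bracket_add_left: "bracket (x + y) z = bracket x z + bracket y z"
    and bracket_add_right: "bracket x (y + z) = bracket x y + bracket x z"
    and bracket_scale_left: "bracket (scale c x) y = scale c (bracket x y)"
    and bracket_scale_right: "bracket x (scale c y) = scale c (bracket x y)"
    and bracket_self: "bracket x x = 0"
    and jacobi: "bracket x (bracket y z) + bracket y (bracket z x) + bracket z (bracket x y) = 0"

definition half_derivation ::
    "(complex \<Rightarrow> 'v::ab_group_add \<Rightarrow> 'v) \<Rightarrow> ('v \<Rightarrow> 'v \<Rightarrow> 'v) \<Rightarrow> ('v \<Rightarrow> 'v) \<Rightarrow> bool" where
  "half_derivation scale bracket \<phi> \<longleftrightarrow>
     Vector_Spaces.linear scale scale \<phi> \<and>
     (\<forall>x y. \<phi> (bracket x y) = scale (1/2) (bracket (\<phi> x) y + bracket x (\<phi> y)))"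

definition trivial_half_derivation ::
    "(complex \<Rightarrow> 'v::ab_group_add \<Rightarrow> 'v) \<Rightarrow> ('v \<Rightarrow> 'v) \<Rightarrow> bool" where
  "trivial_half_derivation scale \<phi> \<longleftrightarrow> (\<exists>c. \<forall>x. \<phi> x = scale c x)"

text \<open>
  The underlying space of \<open>W(a,b)\<close> is the free complex vector space on the symbols
  \<open>L i\<close> and \<open>I j\<close>, realised as the finitely supported functions on them.
\<close>

datatype w_index = IdxL int | IdxI int

type_synonym w_alg = "w_index \<Rightarrow>\<^sub>0 complex"

definition w_scale :: "complex \<Rightarrow> w_alg \<Rightarrow> w_alg" where
  "w_scale c x = Poly_Mapping.map ((*) c) x"

definition L :: "int \<Rightarrow> w_alg" where
  "L i = Poly_Mapping.single (IdxL i) 1"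

definition I :: "int \<Rightarrow> w_alg" where
  "I j = Poly_Mapping.single (IdxI j) 1"

fun w_basis_bracket :: "complex \<Rightarrow> complex \<Rightarrow> w_index \<Rightarrow> w_index \<Rightarrow> w_alg" where
  "w_basis_bracket a b (IdxL m) (IdxL n) = w_scale (of_int (m - n)) (L (m + n))"
| "w_basis_bracket a b (IdxL m) (IdxI n) = w_scale (- (of_int n + a + b * of_int m)) (I (m + n))"
| "w_basis_bracket a b (IdxI m) (IdxL n) = w_scale (of_int m + a + b * of_int n) (I (m + n))"
| "w_basis_bracket a b (IdxI m) (IdxI n) = 0"

definition w_bracket :: "complex \<Rightarrow> complex \<Rightarrow> w_alg \<Rightarrow> w_alg \<Rightarrow> w_alg" where
  "w_bracket a b x y =
     (\<Sum>p\<in>Poly_Mapping.keys x. \<Sum>q\<in>Poly_Mapping.keys y. w_scale (Poly_Mapping.lookup x p * Poly_Mapping.lookup y q) (w_basis_bracket a b p q))"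

lemma lookup_w_scale [simp]: "Poly_Mapping.lookup (w_scale c x) p = c * Poly_Mapping.lookup x p"
  by (simp add: w_scale_def map.rep_eq when_def)

interpretation w: vector_space w_scale
  by unfold_locales (auto intro!: poly_mapping_eqI simp: lookup_add algebra_simps)

lemma w_bracket_superset:
  assumes "finite A" "finite B" "Poly_Mapping.keys x \<subseteq> A" "Poly_Mapping.keys y \<subseteq> B"
  shows "w_bracket a b x y =
    (\<Sum>p\<in>A. \<Sum>q\<in>B. w_scale (Poly_Mapping.lookup x p * Poly_Mapping.lookup y q) (w_basis_bracket a b p q))"
proof -
  have "w_bracket a b x y =
      (\<Sum>p\<in>Poly_Mapping.keys x. \<Sum>q\<in>B. w_scale (Poly_Mapping.lookup x p * Poly_Mapping.lookup y q) (w_basis_bracket a b p q))"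
    unfolding w_bracket_def using assms
    by (intro sum.cong sum.mono_neutral_left) (auto simp: in_keys_iff)
  also have "\<dots> = (\<Sum>p\<in>A. \<Sum>q\<in>B. w_scale (Poly_Mapping.lookup x p * Poly_Mapping.lookup y q) (w_basis_bracket a b p q))"
    using assms by (intro sum.mono_neutral_left) (auto simp: in_keys_iff)
  finally show ?thesis .
qed

lemma w_bracket_add_left: "w_bracket a b (x + y) z = w_bracket a b x z + w_bracket a b y z"
proof -
  let ?A = "Poly_Mapping.keys x \<union> Poly_Mapping.keys y"
  have k: "Poly_Mapping.keys (x + y) \<subseteq> ?A" by (rule Poly_Mapping.keys_add)
  show ?thesis
    by (simp add: w_bracket_superset[of ?A "Poly_Mapping.keys z"] k lookup_add algebra_simps sum.distrib)
qed

lemma w_bracket_add_right: "w_bracket a b x (y + z) = w_bracket a b x y + w_bracket a b x z"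
proof -
  let ?B = "Poly_Mapping.keys y \<union> Poly_Mapping.keys z"
  have k: "Poly_Mapping.keys (y + z) \<subseteq> ?B" by (rule Poly_Mapping.keys_add)
  show ?thesis
    by (simp add: w_bracket_superset[of "Poly_Mapping.keys x" ?B] k lookup_add algebra_simps sum.distrib)
qed

lemma keys_w_scale: "Poly_Mapping.keys (w_scale c x) \<subseteq> Poly_Mapping.keys x"
  by (auto simp: in_keys_iff)

lemma w_bracket_scale_left: "w_bracket a b (w_scale c x) y = w_scale c (w_bracket a b x y)"
  by (simp add: w_bracket_superset[of "Poly_Mapping.keys x" "Poly_Mapping.keys y"] keys_w_scale w.scale_sum_right mult.assoc)

lemma w_bracket_scale_right: "w_bracket a b x (w_scale c y) = w_scale c (w_bracket a b x y)"
  by (simp add: w_bracket_superset[of "Poly_Mapping.keys x" "Poly_Mapping.keys y"] keys_w_scale w.scale_sum_right mult_ac)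

lemma w_bracket_single:
  "w_bracket a b (Poly_Mapping.single p 1) (Poly_Mapping.single q 1) = w_basis_bracket a b p q"
  by (simp add: w_bracket_def)

lemma w_bracket_L_L: "w_bracket a b (L m) (L n) = w_scale (of_int (m - n)) (L (m + n))"
  by (simp add: L_def w_bracket_single)

lemma w_bracket_L_I:
  "w_bracket a b (L m) (I n) = w_scale (- (of_int n + a + b * of_int m)) (I (m + n))"
  by (simp add: L_def I_def w_bracket_single)

lemma w_bracket_I_L:
  "w_bracket a b (I m) (L n) = w_scale (of_int m + a + b * of_int n) (I (m + n))"
  by (simp add: L_def I_def w_bracket_single)

lemma w_bracket_I_I: "w_bracket a b (I m) (I n) = 0"
  by (simp add: I_def w_bracket_single)

lemmas w_bracket_basis = w_bracket_L_L w_bracket_L_I w_bracket_I_L w_bracket_I_I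

lemma w_basis_decomposition:
  "x = (\<Sum>p\<in>Poly_Mapping.keys x. w_scale (Poly_Mapping.lookup x p) (Poly_Mapping.single p 1))"
proof (rule poly_mapping_eqI)
  fix k
  have "Poly_Mapping.lookup (\<Sum>p\<in>Poly_Mapping.keys x. w_scale (Poly_Mapping.lookup x p) (Poly_Mapping.single p 1)) k =
      (\<Sum>p\<in>Poly_Mapping.keys x. if p = k then Poly_Mapping.lookup x p else 0)"
    unfolding lookup_sum by (rule sum.cong) (simp_all add: lookup_single when_def)
  also have "\<dots> = Poly_Mapping.lookup x k"
    by (simp add: in_keys_iff)
  finally show "Poly_Mapping.lookup x k =
      Poly_Mapping.lookup (\<Sum>p\<in>Poly_Mapping.keys x. w_scale (Poly_Mapping.lookup x p) (Poly_Mapping.single p 1)) k" ..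
qed

lemma single_one_eq_iff:
  "Poly_Mapping.single p (1::complex) = Poly_Mapping.single q 1 \<longleftrightarrow> p = q"
proof
  assume "Poly_Mapping.single p (1::complex) = Poly_Mapping.single q 1"
  then have "Poly_Mapping.keys (Poly_Mapping.single p (1::complex)) =
      Poly_Mapping.keys (Poly_Mapping.single q (1::complex))"
    by (rule arg_cong)
  then show "p = q" by simp
qed simp

lemma range_single_eq: "range (\<lambda>p. Poly_Mapping.single p (1::complex)) = range L \<union> range I"
proof -
  have idx: "UNIV = range IdxL \<union> range IdxI"
    by (auto intro: w_index.exhaust)
  show ?thesis
    unfolding idx image_Un image_image L_def I_def by simp
qed

lemma w_basis_span: "w.span (range L \<union> range I) = UNIV"
proof -
  have "x \<in> w.span (range L \<union> range I)" for x
    by (subst w_basis_decomposition[of x], intro w.span_sum w.span_scale w.span_base)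
      (auto simp flip: range_single_eq)
  then show ?thesis by auto
qed

lemma w_basis_inj: "inj L" "inj I" "range L \<inter> range I = {}"
  by (auto simp: inj_def L_def I_def single_one_eq_iff)

lemma w_basis_independent: "w.independent (range L \<union> range I)"
proof -
  let ?s = "\<lambda>p. Poly_Mapping.single p (1::complex)"
  have inj: "inj ?s" by (auto simp: inj_def single_one_eq_iff)
  have "w.independent (range ?s)"
    unfolding w.independent_explicit_module
  proof (intro allI impI)
    fix T u v
    assume T: "finite T" "T \<subseteq> range ?s" and z: "(\<Sum>v\<in>T. w_scale (u v) v) = 0" and "v \<in> T"
    obtain q where q: "v = ?s q" using T \<open>v \<in> T\<close> by auto
    have "0 = Poly_Mapping.lookup (\<Sum>v\<in>T. w_scale (u v) v) q" by (simp add: z)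
    also have "\<dots> = (\<Sum>w\<in>T. if w = v then u w else 0)"
      unfolding lookup_sum
      using T q by (intro sum.cong) (auto simp: lookup_single when_def single_one_eq_iff)
    also have "\<dots> = u v" using T \<open>v \<in> T\<close> by simp
    finally show "u v = 0" by simp
  qed
  then show ?thesis by (simp add: range_single_eq)
qed

lemma w_linear_eq_0:
  assumes "\<And>x y. f (x + y) = f x + f y" "\<And>c x. f (w_scale c x) = w_scale c (f x)"
    and "\<And>m. f (L m) = 0" "\<And>m. f (I m) = 0"
  shows "f x = 0"
proof -
  have "x \<in> w.span (range L \<union> range I)" by (simp add: w_basis_span)
  then show ?thesis
  proof (induction rule: w.span_induct_alt)
    case base
    show ?case using assms(1)[of 0 0] by simp
  next
    case (step c x y)
    then show ?case using assms by auto
  qed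
qed

lemmas w_bracket_linear =
  w_bracket_add_left w_bracket_add_right w_bracket_scale_left w_bracket_scale_right

lemma w_bracket_antisym: "w_bracket a b x y + w_bracket a b y x = 0"
proof (rule w_linear_eq_0[where x = x])
  fix m
  show "w_bracket a b (L m) y + w_bracket a b y (L m) = 0"
    by (rule w_linear_eq_0[where x = y])
      (simp_all add: w_bracket_linear w.scale_right_distrib w_bracket_basis add.commute
        flip: w.scale_left_distrib)
  show "w_bracket a b (I m) y + w_bracket a b y (I m) = 0"
    by (rule w_linear_eq_0[where x = y])
      (simp_all add: w_bracket_linear w.scale_right_distrib w_bracket_basis add.commute
        flip: w.scale_left_distrib)
qed (simp_all add: w_bracket_linear w.scale_right_distrib)

lemma w_bracket_jacobi:
  "w_bracket a b x (w_bracket a b y z) + w_bracket a b y (w_bracket a b z x)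
     + w_bracket a b z (w_bracket a b x y) = 0"
proof -
  let ?J = "\<lambda>x y z. w_bracket a b x (w_bracket a b y z) + w_bracket a b y (w_bracket a b z x)
     + w_bracket a b z (w_bracket a b x y)"
  note lin = w_bracket_linear w.scale_right_distrib
  have three: "w_scale c v + w_scale d v + w_scale e v = 0" if "c + d + e = 0" for c d e v
    using that by (simp flip: w.scale_left_distrib)
  have LLL: "?J (L k) (L m) (L n) = 0" for k m n
  proof -
    have eqs: "m + (n + k) = k + (m + n)" "n + (k + m) = k + (m + n)" by simp_all
    show ?thesis
      unfolding w_bracket_basis w_bracket_linear eqs w.scale_scale
      by (rule three) (simp add: algebra_simps)
  qed
  have LLI: "?J (L k) (L m) (I n) = 0" for k m n
  proof -
    have eqs: "m + (n + k) = k + (m + n)" "n + (k + m) = k + (m + n)" by simp_all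
    show ?thesis
      unfolding w_bracket_basis w_bracket_linear eqs w.scale_scale
      by (rule three) (simp add: algebra_simps)
  qed
  have LIL: "?J (L k) (I m) (L n) = 0" for k m n
    using LLI[of n k m] by (simp only: ac_simps)
  have ILL: "?J (I k) (L m) (L n) = 0" for k m n
    using LLI[of m n k] by (simp only: ac_simps)
  have zero: "w_bracket a b u 0 = 0" for u
    using w_bracket_add_right[of a b u 0 0] by simp
  have basis: "?J x y z = 0"
    if "x \<in> range L \<union> range I" "y \<in> range L \<union> range I" "z \<in> range L \<union> range I" for x y z
    using that LLL LLI LIL ILL
    by (elim UnE imageE) (simp_all add: w_bracket_basis w_bracket_linear zero)
  have 1: "?J x y z = 0" if "x \<in> range L \<union> range I" "y \<in> range L \<union> range I" for x y z
    by (rule w_linear_eq_0[where x = z]) (use that in \<open>auto simp: lin intro!: basis\<close>)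
  have 2: "?J x y z = 0" if "x \<in> range L \<union> range I" for x y z
    by (rule w_linear_eq_0[where x = y]) (use that in \<open>auto simp: lin intro!: 1\<close>)
  show ?thesis
    by (rule w_linear_eq_0[where x = x]) (auto simp: lin intro!: 2)
qed

interpretation w: complex_lie_algebra w_scale "w_bracket a b" for a b
proof
  show "w_bracket a b x x = 0" for x
  proof (rule poly_mapping_eqI)
    fix k
    have "Poly_Mapping.lookup (w_bracket a b x x + w_bracket a b x x) k = 0"
      by (simp add: w_bracket_antisym)
    then show "Poly_Mapping.lookup (w_bracket a b x x) k = Poly_Mapping.lookup 0 k"
      by (simp add: lookup_add)
  qed
qed (simp_all add: w_bracket_linear w_bracket_jacobi)

end

theory Submission
  imports Defs
begin

text \<open>
  The bracket is graded by the index, so the defining identity of a half-derivation \<open>\<phi>\<close>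
  decouples over degrees. Fix a degree \<open>t\<close> and write
  \<open>\<alpha> m\<close>, \<open>\<beta> m\<close> for the coefficients of \<open>L (m + t)\<close>, \<open>I (m + t)\<close> in \<open>\<phi> (L m)\<close>, and
  \<open>\<gamma> m\<close>, \<open>\<delta> m\<close> for those in \<open>\<phi> (I m)\<close>. The brackets \<open>[L m, L n]\<close> and
  \<open>[L m, I n]\<close> then give four functional equations on the integers: one for \<open>\<alpha>\<close>, one for
  \<open>\<beta>\<close>, one for \<open>\<gamma>\<close>, and one coupling \<open>\<delta>\<close> to \<open>\<alpha>\<close>.

  In each of them, bracketing with \<open>L 0\<close> leads to an equation of the form
  \<open>(affine in m) * (unknown m) = (affine in m) * (constant)\<close>, which determines the unknown
  except at the at most one index where the left factor vanishes. The exceptional index is treated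
  by an instance of the functional equation in which all other unknowns are already known. In this
  way \<open>\<alpha>\<close> is constant (\<open>L_to_L_constant\<close>) and \<open>\<gamma>\<close> vanishes (\<open>I_to_L_zero\<close>).

  The value \<open>b = -1\<close> enters through \<open>\<beta>\<close> and \<open>\<delta>\<close>. Eliminating the unknowns from the
  functional equation leaves a polynomial in the indices, times \<open>\<beta> 0\<close> or times the constant value
  of \<open>\<alpha>\<close>, and this polynomial has the factor \<open>b + 1\<close>
  (\<open>L_to_I_compatibility\<close>, \<open>I_to_I_compatibility\<close>). If \<open>b \<noteq> -1\<close>, the remaining factor cannot
  vanish at all indices, except for \<open>\<alpha>\<close> when \<open>t = 0\<close>, where \<open>\<phi>\<close> may act as a scalar, and for
  \<open>\<beta>\<close> when \<open>b = 0\<close> and \<open>t + a = 0\<close>; in the latter case the bracket of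
  \<open>L 1\<close> and \<open>L (-1)\<close> settles the matter. Hence
  \<open>\<beta> = 0\<close> in every degree and \<open>\<alpha> = \<delta> = 0\<close> in every degree \<open>t \<noteq> 0\<close>, while for
  \<open>t = 0\<close> the function \<open>\<delta>\<close> equals the constant \<open>\<alpha>\<close>: so \<open>\<phi>\<close> is a scalar. If
  \<open>b = -1\<close>, the obstruction disappears, \<open>\<beta>\<close> is constant and \<open>\<delta> = \<alpha>\<close> in every degree,
  and the coefficients of \<open>\<phi> (L 0)\<close> are the two required families.
\<close>

section \<open>Coefficients of brackets\<close>

text \<open>
  The coefficient formulas below are identities of linear functionals, so they need to be
  checked on the basis only.
\<close>
lemma w_linear_eqI:
  assumes "\<And>x y. f (x + y) = f x + f y" "\<And>c x. f (w_scale c x) = c * f x"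
    and "\<And>x y. g (x + y) = g x + g y" "\<And>c x. g (w_scale c x) = c * g x"
    and "\<And>m. f (L m) = g (L m)" "\<And>m. f (I m) = g (I m)"
  shows "f x = (g x :: complex)"
proof -
  have "x \<in> w.span (range L \<union> range I)" by (simp add: w_basis_span)
  then show ?thesis
  proof (induction rule: w.span_induct_alt)
    case base
    show ?case using assms(1,3)[of 0 0] by simp
  next
    case (step c x y)
    then show ?case using assms by auto
  qed
qed

lemma lookup_L [simp]:
  "Poly_Mapping.lookup (L i) (IdxL k) = (if i = k then 1 else 0)"
  "Poly_Mapping.lookup (L i) (IdxI k) = 0"
  by (simp_all add: L_def lookup_single when_def)

lemma lookup_I [simp]:
  "Poly_Mapping.lookup (I i) (IdxI k) = (if i = k then 1 else 0)"
  "Poly_Mapping.lookup (I i) (IdxL k) = 0"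
  by (simp_all add: I_def lookup_single when_def)

lemma lookup_bracket_L:
  "Poly_Mapping.lookup (w_bracket a b x (L n)) (IdxL (k + n)) =
     (of_int k - of_int n) * Poly_Mapping.lookup x (IdxL k)"
  "Poly_Mapping.lookup (w_bracket a b x (L n)) (IdxI (k + n)) =
     (of_int k + a + b * of_int n) * Poly_Mapping.lookup x (IdxI k)"
  by (rule w_linear_eqI[where x = x];
      simp add: w_bracket_linear w_bracket_basis lookup_add distrib_left)+

lemma lookup_bracket_I:
  "Poly_Mapping.lookup (w_bracket a b x (I n)) (IdxL (k + n)) = 0"
  "Poly_Mapping.lookup (w_bracket a b x (I n)) (IdxI (k + n)) =
     - (of_int n + a + b * of_int k) * Poly_Mapping.lookup x (IdxL k)"
  by (rule w_linear_eqI[where x = x];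
      simp add: w_bracket_linear w_bracket_basis lookup_add distrib_left)+

lemma w_bracket_swap: "w_bracket a b x y = - w_bracket a b y x"
  using w_bracket_antisym[of a b x y] by (simp add: eq_neg_iff_add_eq_0)

text \<open>
  Both images are placed in the left argument of the bracket, so that only the brackets with a
  basis vector on the right have to be expanded in coordinates.
\<close>
lemma lookup_half_derivation_bracket:
  assumes "half_derivation w_scale (w_bracket a b) \<phi>"
  shows "2 * Poly_Mapping.lookup (\<phi> (w_bracket a b x y)) p =
    Poly_Mapping.lookup (w_bracket a b (\<phi> x) y) p - Poly_Mapping.lookup (w_bracket a b (\<phi> y) x) p"
proof -
  have "\<phi> (w_bracket a b x y) =
      w_scale (1/2) (w_bracket a b (\<phi> x) y + w_bracket a b x (\<phi> y))"
    using assms unfolding half_derivation_def by blast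
  also have "w_bracket a b x (\<phi> y) = - w_bracket a b (\<phi> y) x"
    by (rule w_bracket_swap)
  finally show ?thesis
    by (simp add: lookup_add lookup_minus)
qed

lemma half_derivation_scale:
  assumes "half_derivation w_scale (w_bracket a b) \<phi>"
  shows "\<phi> (w_scale c x) = w_scale c (\<phi> x)"
proof -
  interpret Vector_Spaces.linear w_scale w_scale \<phi>
    using assms by (simp add: half_derivation_def)
  show ?thesis by (rule scale)
qed

section \<open>The functional equations in a fixed degree\<close>

text \<open>
  These are the coefficients at index \<open>m + n + t\<close> of the half-derivation identity for
  \<open>[L m, L n]\<close> and \<open>[L m, I n]\<close>. Only images at indices shifted by the same \<open>t\<close> contribute,
  because the bracket adds indices.
\<close>
lemma
  assumes "half_derivation w_scale (w_bracket a b) \<phi>"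
  shows L_coeff_of_bracket_L_L:
    "2 * (of_int m - of_int n) * Poly_Mapping.lookup (\<phi> (L (m + n))) (IdxL (m + n + t)) =
       (of_int m + of_int t - of_int n) * Poly_Mapping.lookup (\<phi> (L m)) (IdxL (m + t))
       + (of_int m - of_int n - of_int t) * Poly_Mapping.lookup (\<phi> (L n)) (IdxL (n + t))"
  and I_coeff_of_bracket_L_L:
    "2 * (of_int m - of_int n) * Poly_Mapping.lookup (\<phi> (L (m + n))) (IdxI (m + n + t)) =
       (of_int m + (of_int t + a) + b * of_int n) * Poly_Mapping.lookup (\<phi> (L m)) (IdxI (m + t))
       - (of_int n + (of_int t + a) + b * of_int m) * Poly_Mapping.lookup (\<phi> (L n)) (IdxI (n + t))"
  and L_coeff_of_bracket_L_I:
    "2 * (of_int n + a + b * of_int m) * Poly_Mapping.lookup (\<phi> (I (m + n))) (IdxL (m + n + t)) =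
       (of_int n + of_int t - of_int m) * Poly_Mapping.lookup (\<phi> (I n)) (IdxL (n + t))"
  and I_coeff_of_bracket_L_I:
    "2 * (of_int n + a + b * of_int m) * Poly_Mapping.lookup (\<phi> (I (m + n))) (IdxI (m + n + t)) =
       (of_int n + a + b * of_int m + b * of_int t) * Poly_Mapping.lookup (\<phi> (L m)) (IdxL (m + t))
       + (of_int n + a + b * of_int m + of_int t) * Poly_Mapping.lookup (\<phi> (I n)) (IdxI (n + t))"
proof -
  note coeffs = lookup_half_derivation_bracket[OF assms] half_derivation_scale[OF assms]
    w_bracket_basis
  have shift: "Poly_Mapping.lookup (w_bracket a b x (L n)) (IdxL (m + n + t)) =
       (of_int (m + t) - of_int n) * Poly_Mapping.lookup x (IdxL (m + t))"
    "Poly_Mapping.lookup (w_bracket a b x (L n)) (IdxI (m + n + t)) =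
       (of_int (m + t) + a + b * of_int n) * Poly_Mapping.lookup x (IdxI (m + t))"
    "Poly_Mapping.lookup (w_bracket a b x (L m)) (IdxL (m + n + t)) =
       (of_int (n + t) - of_int m) * Poly_Mapping.lookup x (IdxL (n + t))"
    "Poly_Mapping.lookup (w_bracket a b x (L m)) (IdxI (m + n + t)) =
       (of_int (n + t) + a + b * of_int m) * Poly_Mapping.lookup x (IdxI (n + t))"
    "Poly_Mapping.lookup (w_bracket a b x (I n)) (IdxL (m + n + t)) = 0"
    "Poly_Mapping.lookup (w_bracket a b x (I n)) (IdxI (m + n + t)) =
       - (of_int n + a + b * of_int (m + t)) * Poly_Mapping.lookup x (IdxL (m + t))"
    for x
    using lookup_bracket_L[of a b x n "m + t"] lookup_bracket_L[of a b x m "n + t"]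
      lookup_bracket_I[of a b x n "m + t"]
    by (simp_all only: ac_simps)
  show "2 * (of_int m - of_int n) * Poly_Mapping.lookup (\<phi> (L (m + n))) (IdxL (m + n + t)) =
       (of_int m + of_int t - of_int n) * Poly_Mapping.lookup (\<phi> (L m)) (IdxL (m + t))
       + (of_int m - of_int n - of_int t) * Poly_Mapping.lookup (\<phi> (L n)) (IdxL (n + t))"
    using coeffs(1)[of "L m" "L n" "IdxL (m + n + t)"]
    by (simp add: coeffs(2-) shift) (simp add: algebra_simps)
  show "2 * (of_int m - of_int n) * Poly_Mapping.lookup (\<phi> (L (m + n))) (IdxI (m + n + t)) =
       (of_int m + (of_int t + a) + b * of_int n) * Poly_Mapping.lookup (\<phi> (L m)) (IdxI (m + t))
       - (of_int n + (of_int t + a) + b * of_int m) * Poly_Mapping.lookup (\<phi> (L n)) (IdxI (n + t))"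
    using coeffs(1)[of "L m" "L n" "IdxI (m + n + t)"]
    by (simp add: coeffs(2-) shift) (simp add: algebra_simps)
  show "2 * (of_int n + a + b * of_int m) * Poly_Mapping.lookup (\<phi> (I (m + n))) (IdxL (m + n + t)) =
       (of_int n + of_int t - of_int m) * Poly_Mapping.lookup (\<phi> (I n)) (IdxL (n + t))"
    using coeffs(1)[of "L m" "I n" "IdxL (m + n + t)"]
    by (simp add: coeffs(2-) shift) (simp add: algebra_simps)
  show "2 * (of_int n + a + b * of_int m) * Poly_Mapping.lookup (\<phi> (I (m + n))) (IdxI (m + n + t)) =
       (of_int n + a + b * of_int m + b * of_int t) * Poly_Mapping.lookup (\<phi> (L m)) (IdxL (m + t))
       + (of_int n + a + b * of_int m + of_int t) * Poly_Mapping.lookup (\<phi> (I n)) (IdxI (n + t))"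
    using coeffs(1)[of "L m" "I n" "IdxI (m + n + t)"]
    by (simp add: coeffs(2-) shift) (simp add: algebra_simps)
qed

section \<open>Solving the functional equations\<close>

text \<open>
  The equation with \<open>n = 0\<close> reads \<open>(m - t) * (\<alpha> m - \<alpha> 0) = 0\<close>; only the index \<open>t\<close> is left
  open, and it is reached as a sum of two other indices.
\<close>
lemma L_to_L_constant:
  fixes \<alpha> :: "int \<Rightarrow> complex" and t :: int
  assumes E: "\<And>m n. 2 * (of_int m - of_int n) * \<alpha> (m + n) =
       (of_int m + of_int t - of_int n) * \<alpha> m + (of_int m - of_int n - of_int t) * \<alpha> n"
  shows "\<alpha> m = \<alpha> 0"
proof -
  have generic: "\<alpha> k = \<alpha> 0" if "k \<noteq> t" for k
  proof -
    have "(of_int k - of_int t) * (\<alpha> k - \<alpha> 0) = 0"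
      using E[of k 0] by (simp add: algebra_simps)
    with that show ?thesis by simp
  qed
  show ?thesis
  proof (cases "m = t \<and> t \<noteq> 0")
    case True
    \<comment> \<open>The index \<open>t\<close> is the sum of \<open>t - n\<close> and \<open>n\<close>, where \<open>\<alpha>\<close> is known; \<open>2 n \<noteq> t\<close> keeps the
      equation from being void.\<close>
    define n where "n = \<bar>t\<bar> + 1"
    have n: "n \<noteq> 0" "n \<noteq> t" "t - n \<noteq> t" "t - 2 * n \<noteq> 0" by (auto simp: n_def)
    have "2 * of_int (t - 2 * n) * (\<alpha> t - \<alpha> 0) = 0"
      using E[of "t - n" n] n by (simp add: generic[of n] generic[of "t - n"] algebra_simps)
    then show ?thesis using n(4) True by (simp del: of_int_diff)
  next
    case False
    then show ?thesis using generic by (cases "m = 0") auto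
  qed
qed

text \<open>
  The equation with \<open>m = 0\<close> confines the support of \<open>\<gamma>\<close> to the single index \<open>t - 2 a\<close>.
  Starting there, every step \<open>m \<noteq> 0\<close> leaves the support, which forces \<open>\<gamma>\<close> to vanish there too.
\<close>
lemma I_to_L_zero:
  fixes a b :: complex and \<gamma> :: "int \<Rightarrow> complex" and t :: int
  assumes E: "\<And>m n. 2 * (of_int n + a + b * of_int m) * \<gamma> (m + n) =
       (of_int n + of_int t - of_int m) * \<gamma> n"
  shows "\<gamma> n = 0"
proof (rule ccontr)
  assume nz: "\<gamma> n \<noteq> 0"
  have *: "(2 * a + of_int k - of_int t) * \<gamma> k = 0" for k
    using E[of k 0] by (simp add: algebra_simps)
  have off: "\<gamma> (m + n) = 0" if "m \<noteq> 0" for m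
  proof -
    have "2 * a + of_int n - of_int t = 0" using *[of n] nz by simp
    then have "2 * a + of_int (m + n) - of_int t = of_int m" by (simp add: algebra_simps)
    from *[of "m + n", unfolded this] that show ?thesis by simp
  qed
  \<comment> \<open>A nonzero step for which the right-hand factor \<open>n + t - m\<close> does not vanish.\<close>
  define m where "m = \<bar>n + t\<bar> + 1"
  have m: "m \<noteq> 0" "n + t - m \<noteq> 0" by (auto simp: m_def)
  have "of_int (n + t - m) * \<gamma> n = 0"
    using E[of n m] off[OF m(1)] by simp
  with nz m(2) show False by (simp del: of_int_add of_int_diff)
qed

text \<open>
  Here \<open>A\<close> is the constant value of \<open>\<alpha>\<close>. Under the hypothesis on \<open>t\<close> and \<open>b\<close> the terms
  \<open>b t\<close> and \<open>-t\<close> agree, so that the equation with \<open>m = 0\<close> reads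
  \<open>(n + a - t) * (\<delta> n - A) = 0\<close>.
\<close>
lemma I_to_I_constant:
  fixes a b A :: complex and \<delta> :: "int \<Rightarrow> complex" and t :: int
  assumes E: "\<And>m n. 2 * (of_int n + a + b * of_int m) * \<delta> (m + n) =
       (of_int n + a + b * of_int m + b * of_int t) * A
       + (of_int n + a + b * of_int m + of_int t) * \<delta> n"
    and "t = 0 \<or> b = -1"
  shows "\<delta> n = A"
proof -
  have *: "(of_int k + a - of_int t) * (\<delta> k - A) = 0" for k
    using E[of k 0] assms(2) by (auto simp: algebra_simps)
  show ?thesis
  proof (cases "of_int n + a = of_int t")
    case False
    then show ?thesis using *[of n] by simp
  next
    case True
    have off: "\<delta> (m + n) = A" if "m \<noteq> 0" for m
    proof -
      have "of_int (m + n) + a - of_int t = of_int m" using True by (simp add: algebra_simps)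
      from *[of "m + n", unfolded this] that show ?thesis by simp
    qed
    \<comment> \<open>A nonzero step other than \<open>2 t\<close>, where for \<open>b = -1\<close> the coefficient of \<open>\<delta> n\<close> vanishes.\<close>
    define m where "m = 2 * \<bar>t\<bar> + 1"
    have m: "m \<noteq> 0" "2 * t - m \<noteq> 0" by (auto simp: m_def)
    have "\<delta> (m + n) = A" using off m by simp
    show ?thesis
    proof (cases "b = -1")
      case True
      have "of_int (2 * t - m) * (\<delta> n - A) = 0"
        using E[of n m, unfolded \<open>of_int n + a = of_int t\<close>] \<open>\<delta> (m + n) = A\<close> True
        by (simp add: algebra_simps)
      then show ?thesis using m(2) by (simp del: of_int_diff)
    next
      case False
      then have "t = 0" using assms(2) by simp
      show ?thesis
      \<comment> \<open>For \<open>b = 0\<close> the equation that starts at the exceptional index \<open>n\<close> is void; the one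
        that ends there determines \<open>\<delta> n\<close>.\<close>
      proof (cases "b = 0")
        case True
        have "\<delta> (- 1 + n) = A" by (rule off) simp
        moreover have "of_int n = - a" using \<open>of_int n + a = of_int t\<close> \<open>t = 0\<close>
          by (simp add: eq_neg_iff_add_eq_0)
        ultimately show ?thesis
          using E[of "n - 1" 1] True \<open>t = 0\<close> by (simp add: algebra_simps)
      next
        case False
        have "b * of_int m * (\<delta> n - A) = 0"
          using E[of n m, unfolded \<open>of_int n + a = of_int t\<close>] \<open>\<delta> (m + n) = A\<close> \<open>t = 0\<close>
          by (auto simp: algebra_simps)
        then show ?thesis using False m(1) by simp
      qed
    qed
  qed
qed

text \<open>
  This eliminates \<open>d = \<delta> n\<close> and \<open>d' = \<delta> (m + n)\<close>, where \<open>x = n + a\<close>: the first equation is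
  multiplied by \<open>(x - t) * (x + m - t)\<close>, and the other two replace the unknowns by multiples of
  \<open>A\<close>.
\<close>
lemma I_to_I_compatibility:
  fixes x b m t A d d' :: complex
  assumes "2 * (x + b * m) * d' = (x + b * m + b * t) * A + (x + b * m + t) * d"
    and "(x - t) * d = (x + b * t) * A"
    and "(x + m - t) * d' = (x + m + b * t) * A"
  shows "(b + 1) * t * m * (((b - 2) * x - b * t - b * m) * A) = 0"
proof -
  have "(b + 1) * t * m * (((b - 2) * x - b * t - b * m) * A) =
      (x - t) * (x + m - t) *
        (2 * (x + b * m) * d' - ((x + b * m + b * t) * A + (x + b * m + t) * d))
      - 2 * (x + b * m) * (x - t) * ((x + m - t) * d' - (x + m + b * t) * A)
      + (x + b * m + t) * (x + m - t) * ((x - t) * d - (x + b * t) * A)"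
    by algebra
  then show ?thesis using assms by simp
qed

text \<open>
  The compatibility condition, which is affine in \<open>n\<close> and in \<open>m \<noteq> 0\<close>, has coefficients
  \<open>(b - 2) A\<close> and \<open>- b A\<close>. Both vanish only if \<open>A = 0\<close>.
  Then \<open>\<delta>\<close> lives on the single index with \<open>n + a = t\<close>, and a nonzero value there would
  require \<open>2 t + b m = 0\<close> for all \<open>m \<noteq> 0\<close>.
\<close>
lemma I_to_I_zero:
  fixes a b A :: complex and \<delta> :: "int \<Rightarrow> complex" and t :: int
  assumes E: "\<And>m n. 2 * (of_int n + a + b * of_int m) * \<delta> (m + n) =
       (of_int n + a + b * of_int m + b * of_int t) * A
       + (of_int n + a + b * of_int m + of_int t) * \<delta> n"
    and "t \<noteq> 0" "b \<noteq> -1"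
  shows "A = 0" "\<delta> n = 0"
proof -
  have *: "(of_int k + a - of_int t) * \<delta> k = (of_int k + a + b * of_int t) * A" for k
    using E[of k 0] by (simp add: algebra_simps)
  have elim: "((b - 2) * (of_int k + a) - b * of_int t - b * of_int m) * A = 0"
    if "m \<noteq> 0" for k m
  proof -
    have "(b + 1) * of_int t * of_int m *
        (((b - 2) * (of_int k + a) - b * of_int t - b * of_int m) * A) = 0"
      using E[of k m] *[of k] *[of "m + k"]
      by (intro I_to_I_compatibility[where ?d = "\<delta> k" and ?d' = "\<delta> (m + k)"]) (simp_all add: ac_simps)
    then show ?thesis using assms(2,3) that by (simp add: eq_neg_iff_add_eq_0)
  qed
  have "b * A = 0" using elim[of 1 0] elim[of 2 0] by (simp add: algebra_simps)
  moreover have "(b - 2) * A = 0" using elim[of 1 0] elim[of 1 1] by (simp add: algebra_simps)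
  ultimately show "A = 0" by auto
  show "\<delta> n = 0"
  proof (rule ccontr)
    assume nz: "\<delta> n \<noteq> 0"
    have n: "of_int n + a = of_int t" using *[of n] nz \<open>A = 0\<close> by simp
    have "2 * of_int t + b * of_int m = 0" if "m \<noteq> 0" for m
    proof -
      have "of_int (m + n) + a - of_int t = of_int m" using n by (simp add: algebra_simps)
      from *[of "m + n", unfolded this] have "\<delta> (m + n) = 0" using that \<open>A = 0\<close> by simp
      with E[of n m, unfolded n] \<open>A = 0\<close> have "(2 * of_int t + b * of_int m) * \<delta> n = 0"
        by (simp add: algebra_simps)
      with nz show ?thesis by simp
    qed
    from this[of 1] this[of 2] have "2 * of_int t + b = 0" "2 * of_int t + 2 * b = 0"
      by (simp_all add: mult.commute)
    moreover have "b = (2 * of_int t + 2 * b) - (2 * of_int t + b)" by simp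
    ultimately have "b = 0" by simp
    with \<open>2 * of_int t + b = 0\<close> \<open>t \<noteq> 0\<close> show False by simp
  qed
qed

text \<open>
  The same elimination for \<open>\<beta>\<close>, with \<open>u = \<beta> m\<close>, \<open>v = \<beta> n\<close>, \<open>w = \<beta> (m + n)\<close> and
  \<open>B = \<beta> 0\<close>: the first equation is multiplied by the three factors on the left of the others.
\<close>
lemma L_to_I_compatibility:
  fixes m n b c u v w B :: complex
  assumes "2 * (m - n) * w = (m + c + b * n) * u - (n + c + b * m) * v"
    and "(m - c) * u = - (c + b * m) * B"
    and "(n - c) * v = - (c + b * n) * B"
    and "(m + n - c) * w = - (c + b * (m + n)) * B"
  shows "(b + 1) * m * n * (m - n) * ((b * (m + n) + (2 - b) * c) * B) = 0"
proof -
  have "(b + 1) * m * n * (m - n) * ((b * (m + n) + (2 - b) * c) * B) =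
      2 * (m - n) * (m - c) * (n - c) * ((m + n - c) * w - - (c + b * (m + n)) * B)
      - (m + c + b * n) * (n - c) * (m + n - c) * ((m - c) * u - - (c + b * m) * B)
      + (n + c + b * m) * (m - c) * (m + n - c) * ((n - c) * v - - (c + b * n) * B)
      - (m - c) * (n - c) * (m + n - c) *
        (2 * (m - n) * w - ((m + c + b * n) * u - (n + c + b * m) * v))"
    by algebra
  then show ?thesis using assms by simp
qed

text \<open>
  Here and in the next lemma \<open>c = t + a\<close>. If \<open>\<beta> 0 \<noteq> 0\<close>, then comparing the compatibility
  condition at two values of \<open>m + n\<close> yields \<open>b = c = 0\<close>; the brackets with \<open>L 0\<close> then kill
  \<open>\<beta>\<close> at \<open>1\<close> and \<open>-1\<close>, and the bracket of \<open>L 1\<close> with \<open>L (-1)\<close> gives \<open>\<beta> 0 = 0\<close>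
  nevertheless. With \<open>\<beta> 0 = 0\<close> the only index left is \<open>c\<close>.
\<close>
lemma L_to_I_zero:
  fixes b c :: complex and \<beta> :: "int \<Rightarrow> complex"
  assumes E: "\<And>m n. 2 * (of_int m - of_int n) * \<beta> (m + n) =
       (of_int m + c + b * of_int n) * \<beta> m - (of_int n + c + b * of_int m) * \<beta> n"
    and b: "b \<noteq> -1"
  shows "\<beta> m = 0"
proof -
  have *: "(of_int k - c) * \<beta> k = - (c + b * of_int k) * \<beta> 0" for k
    using E[of k 0] by (simp add: algebra_simps)
  have b1: "b + 1 \<noteq> 0" using b by (simp add: eq_neg_iff_add_eq_0)
  have elim: "(b * (of_int k + of_int n) + (2 - b) * c) * \<beta> 0 = 0"
    if "k \<noteq> 0" "n \<noteq> 0" "k \<noteq> n" for k n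
  proof -
    have "(b + 1) * of_int k * of_int n * (of_int k - of_int n) *
        ((b * (of_int k + of_int n) + (2 - b) * c) * \<beta> 0) = 0"
      using E[of k n] *[of k] *[of n] *[of "k + n"]
      by (intro L_to_I_compatibility[where ?u = "\<beta> k" and ?v = "\<beta> n" and ?w = "\<beta> (k + n)"]) simp_all
    then show ?thesis using b1 that by simp
  qed
  have "\<beta> 0 = 0"
  proof (rule ccontr)
    assume nz: "\<beta> 0 \<noteq> 0"
    have "b * 3 + (2 - b) * c = 0" "b * 4 + (2 - b) * c = 0"
      using elim[of 1 2] elim[of 1 3] nz by simp_all
    then have "b = 0" "c = 0" by algebra+
    with \<open>b = 0\<close> have "\<beta> 1 = 0" "\<beta> (-1) = 0" using *[of 1] *[of "-1"] by simp_all
    with E[of 1 "-1"] nz show False by simp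
  qed
  show ?thesis
  proof (rule ccontr)
    assume nz: "\<beta> m \<noteq> 0"
    then have c: "c = of_int m" using *[of m] \<open>\<beta> 0 = 0\<close> by simp
    have "m \<noteq> 0" using nz \<open>\<beta> 0 = 0\<close> by auto
    \<comment> \<open>Pairing \<open>m\<close> with \<open>2 m\<close> gives \<open>\<beta> m\<close> the coefficient \<open>m + c + 2 b m = 2 m (b + 1)\<close>.\<close>
    have "\<beta> k = 0" if "k \<noteq> m" for k using *[of k] \<open>\<beta> 0 = 0\<close> c that by simp
    then have "\<beta> (2 * m) = 0" "\<beta> (m + 2 * m) = 0" using \<open>m \<noteq> 0\<close> by simp_all
    then have "2 * of_int m * (b + 1) * \<beta> m = 0"
      using E[of m "2 * m"] c by (simp add: algebra_simps)
    then show False using nz b1 \<open>m \<noteq> 0\<close> by simp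
  qed
qed

text \<open>
  This is the \<open>\<beta>\<close>-equation for \<open>b = -1\<close>. The factor \<open>c + b m\<close> on the right becomes
  \<open>-(m - c)\<close>, and the exceptional index \<open>c\<close> is recovered from the pair \<open>c\<close>, \<open>-c\<close>.
\<close>
lemma L_to_I_constant:
  fixes c :: complex and \<beta> :: "int \<Rightarrow> complex"
  assumes E: "\<And>m n. 2 * (of_int m - of_int n) * \<beta> (m + n) =
       (of_int m + c - of_int n) * \<beta> m - (of_int n + c - of_int m) * \<beta> n"
  shows "\<beta> m = \<beta> 0"
proof -
  have *: "(of_int k - c) * (\<beta> k - \<beta> 0) = 0" for k
    using E[of k 0] by (simp add: algebra_simps)
  show ?thesis
  proof (cases "c = of_int m \<and> m \<noteq> 0")
    case True
    then have off: "\<beta> k = \<beta> 0" if "k \<noteq> m" for k using *[of k] that by simp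
    have "\<beta> (- m) = \<beta> 0" by (rule off) (use True in auto)
    then have "3 * of_int m * (\<beta> m - \<beta> 0) = 0"
      using E[of m "- m"] True by (simp add: algebra_simps)
    then show ?thesis using True by simp
  qed (use *[of m] in auto)
qed

section \<open>Assembling the half-derivations\<close>

lemma poly_mapping_w_eqI:
  assumes "\<And>k. Poly_Mapping.lookup x (IdxL k) = Poly_Mapping.lookup y (IdxL k)"
    and "\<And>k. Poly_Mapping.lookup x (IdxI k) = Poly_Mapping.lookup y (IdxI k)"
  shows "x = y"
proof (rule poly_mapping_eqI)
  show "Poly_Mapping.lookup x p = Poly_Mapping.lookup y p" for p
    using assms by (cases p) auto
qed

lemma half_derivation_trivialI:
  assumes "half_derivation w_scale (w_bracket a b) \<phi>"
    and "\<And>m. \<phi> (L m) = w_scale c (L m)" "\<And>m. \<phi> (I m) = w_scale c (I m)"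
  shows "trivial_half_derivation w_scale \<phi>"
proof -
  interpret Vector_Spaces.linear w_scale w_scale \<phi>
    using assms(1) by (simp add: half_derivation_def)
  have "\<phi> x - w_scale c x = 0" for x
    by (rule w_linear_eq_0[where x = x])
      (simp_all add: add scale assms(2,3) w.scale_right_distrib w.scale_right_diff_distrib mult.commute)
  then show ?thesis by (auto simp: trivial_half_derivation_def)
qed

lemma lookup_sum_shifts [simp]:
  fixes u :: "int \<Rightarrow> complex"
  assumes "finite {t. u t \<noteq> 0}"
  shows "Poly_Mapping.lookup (\<Sum>t\<in>{t. u t \<noteq> 0}. w_scale (u t) (L (m + t))) (IdxL k) = u (k - m)"
    and "Poly_Mapping.lookup (\<Sum>t\<in>{t. u t \<noteq> 0}. w_scale (u t) (L (m + t))) (IdxI k) = 0"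
    and "Poly_Mapping.lookup (\<Sum>t\<in>{t. u t \<noteq> 0}. w_scale (u t) (I (m + t))) (IdxI k) = u (k - m)"
    and "Poly_Mapping.lookup (\<Sum>t\<in>{t. u t \<noteq> 0}. w_scale (u t) (I (m + t))) (IdxL k) = 0"
proof -
  have shift: "m + t = k \<longleftrightarrow> t = k - m" for t by auto
  have "(\<Sum>t\<in>{t. u t \<noteq> 0}. u t * (if m + t = k then 1 else 0)) = u (k - m)"
    using assms by (simp add: shift if_distrib cong: if_cong)
  then show "Poly_Mapping.lookup (\<Sum>t\<in>{t. u t \<noteq> 0}. w_scale (u t) (L (m + t))) (IdxL k) = u (k - m)"
    and "Poly_Mapping.lookup (\<Sum>t\<in>{t. u t \<noteq> 0}. w_scale (u t) (I (m + t))) (IdxI k) = u (k - m)"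
    by (simp_all add: lookup_sum)
qed (simp_all add: lookup_sum)

lemma finite_lookup_inj:
  assumes "inj f"
  shows "finite {t. Poly_Mapping.lookup x (f t) \<noteq> 0}"
proof -
  have "{t. Poly_Mapping.lookup x (f t) \<noteq> 0} = f -` Poly_Mapping.keys x"
    by (auto simp: in_keys_iff)
  with assms show ?thesis by (simp add: finite_vimageI)
qed

lemma half_derivation_L_coeff_L:
  assumes "half_derivation w_scale (w_bracket a b) \<phi>"
  shows "Poly_Mapping.lookup (\<phi> (L m)) (IdxL k) = Poly_Mapping.lookup (\<phi> (L 0)) (IdxL (k - m))"
  using L_to_L_constant[of "\<lambda>n. Poly_Mapping.lookup (\<phi> (L n)) (IdxL (n + (k - m)))" "k - m" m,
      OF L_coeff_of_bracket_L_L[OF assms]]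
  by simp

lemma half_derivation_I_coeff_L:
  assumes "half_derivation w_scale (w_bracket a b) \<phi>"
  shows "Poly_Mapping.lookup (\<phi> (I m)) (IdxL k) = 0"
  using I_to_L_zero[of a b "\<lambda>n. Poly_Mapping.lookup (\<phi> (I n)) (IdxL (n + (k - m)))" "k - m" m,
      OF L_coeff_of_bracket_L_I[OF assms]]
  by simp

text \<open>
  With the coefficient of \<open>\<phi> (L m)\<close> known to be constant in \<open>m\<close>, the coupled equation takes the
  form that \<open>I_to_I_constant\<close> and \<open>I_to_I_zero\<close> solve.
\<close>
lemma half_derivation_bracket_L_I:
  assumes "half_derivation w_scale (w_bracket a b) \<phi>"
  shows "2 * (of_int n + a + b * of_int m) * Poly_Mapping.lookup (\<phi> (I (m + n))) (IdxI (m + n + t)) =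
       (of_int n + a + b * of_int m + b * of_int t) * Poly_Mapping.lookup (\<phi> (L 0)) (IdxL t)
       + (of_int n + a + b * of_int m + of_int t) * Poly_Mapping.lookup (\<phi> (I n)) (IdxI (n + t))"
  using I_coeff_of_bracket_L_I[OF assms, of n m t]
  by (simp add: half_derivation_L_coeff_L[OF assms, of m])

lemma half_derivation_trivial:
  assumes \<phi>: "half_derivation w_scale (w_bracket a b) \<phi>" and b: "b \<noteq> -1"
  shows "trivial_half_derivation w_scale \<phi>"
proof (rule half_derivation_trivialI[OF \<phi>, of "Poly_Mapping.lookup (\<phi> (L 0)) (IdxL 0)"])
  let ?A = "\<lambda>t. Poly_Mapping.lookup (\<phi> (L 0)) (IdxL t)"
  have A0: "?A t = 0" if "t \<noteq> 0" for t
    using I_to_I_zero(1)[of a b "\<lambda>n. Poly_Mapping.lookup (\<phi> (I n)) (IdxI (n + t))" t,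
        OF half_derivation_bracket_L_I[OF \<phi>] that b] .
  fix m
  show "\<phi> (L m) = w_scale (?A 0) (L m)"
  proof (rule poly_mapping_w_eqI)
    fix k
    show "Poly_Mapping.lookup (\<phi> (L m)) (IdxL k) = Poly_Mapping.lookup (w_scale (?A 0) (L m)) (IdxL k)"
      using A0[of "k - m"] half_derivation_L_coeff_L[OF \<phi>, of m k] by auto
    show "Poly_Mapping.lookup (\<phi> (L m)) (IdxI k) = Poly_Mapping.lookup (w_scale (?A 0) (L m)) (IdxI k)"
      using L_to_I_zero[of "\<lambda>n. Poly_Mapping.lookup (\<phi> (L n)) (IdxI (n + (k - m)))" _ b m,
          OF I_coeff_of_bracket_L_L[OF \<phi>] b] by simp
  qed
  show "\<phi> (I m) = w_scale (?A 0) (I m)"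
  proof (rule poly_mapping_w_eqI)
    fix k
    show "Poly_Mapping.lookup (\<phi> (I m)) (IdxL k) = Poly_Mapping.lookup (w_scale (?A 0) (I m)) (IdxL k)"
      using half_derivation_I_coeff_L[OF \<phi>] by simp
    show "Poly_Mapping.lookup (\<phi> (I m)) (IdxI k) = Poly_Mapping.lookup (w_scale (?A 0) (I m)) (IdxI k)"
    proof (cases "k = m")
      case True
      then show ?thesis
        using I_to_I_constant[of a b "\<lambda>n. Poly_Mapping.lookup (\<phi> (I n)) (IdxI (n + 0))" 0 "?A 0" m,
          OF half_derivation_bracket_L_I[OF \<phi>]] by simp
    next
      case False
      then show ?thesis
        using I_to_I_zero(2)[of a b "\<lambda>n. Poly_Mapping.lookup (\<phi> (I n)) (IdxI (n + (k - m)))" "k - m" _ m,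
          OF half_derivation_bracket_L_I[OF \<phi>] _ b] by simp
    qed
  qed
qed

lemma half_derivation_shifts:
  assumes \<phi>: "half_derivation w_scale (w_bracket a (-1)) \<phi>"
  shows "Poly_Mapping.lookup (\<phi> (L m)) (IdxI k) = Poly_Mapping.lookup (\<phi> (L 0)) (IdxI (k - m))"
    and "Poly_Mapping.lookup (\<phi> (I m)) (IdxI k) = Poly_Mapping.lookup (\<phi> (L 0)) (IdxL (k - m))"
proof -
  have "2 * (of_int i - of_int j) * Poly_Mapping.lookup (\<phi> (L (i + j))) (IdxI (i + j + t)) =
      (of_int i + (of_int t + a) - of_int j) * Poly_Mapping.lookup (\<phi> (L i)) (IdxI (i + t))
      - (of_int j + (of_int t + a) - of_int i) * Poly_Mapping.lookup (\<phi> (L j)) (IdxI (j + t))"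
    for i j t
    using I_coeff_of_bracket_L_L[OF \<phi>, of i j t] by simp
  from L_to_I_constant[of "\<lambda>n. Poly_Mapping.lookup (\<phi> (L n)) (IdxI (n + (k - m)))" _ m, OF this]
  show "Poly_Mapping.lookup (\<phi> (L m)) (IdxI k) = Poly_Mapping.lookup (\<phi> (L 0)) (IdxI (k - m))"
    by simp
  show "Poly_Mapping.lookup (\<phi> (I m)) (IdxI k) = Poly_Mapping.lookup (\<phi> (L 0)) (IdxL (k - m))"
    using I_to_I_constant[of a "-1" "\<lambda>n. Poly_Mapping.lookup (\<phi> (I n)) (IdxI (n + (k - m)))" "k - m" _ m,
        OF half_derivation_bracket_L_I[OF \<phi>]] by simp
qed

theorem theorem21:
  fixes a b :: complex
  shows "(b \<noteq> -1 \<longrightarrow>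
            \<not> (\<exists>\<phi>. half_derivation w_scale (w_bracket a b) \<phi> \<and>
                  \<not> trivial_half_derivation w_scale \<phi>)) \<and>
         (b = -1 \<longrightarrow>
            (\<forall>\<phi>. half_derivation w_scale (w_bracket a (-1)) \<phi> \<longrightarrow>
               (\<exists>\<alpha> \<beta> :: int \<Rightarrow> complex.
                  finite {t. \<alpha> t \<noteq> 0} \<and> finite {t. \<beta> t \<noteq> 0} \<and>
                  (\<forall>m. \<phi> (L m) = (\<Sum>t\<in>{t. \<alpha> t \<noteq> 0}. w_scale (\<alpha> t) (L (m + t)))
                              + (\<Sum>t\<in>{t. \<beta> t \<noteq> 0}. w_scale (\<beta> t) (I (m + t))) \<and>
                       \<phi> (I m) = (\<Sum>t\<in>{t. \<alpha> t \<noteq> 0}. w_scale (\<alpha> t) (I (m + t)))))))"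
proof (intro conjI impI allI)
  show "\<not> (\<exists>\<phi>. half_derivation w_scale (w_bracket a b) \<phi> \<and> \<not> trivial_half_derivation w_scale \<phi>)"
    if "b \<noteq> -1"
    using half_derivation_trivial that by blast
next
  fix \<phi>
  assume \<phi>: "half_derivation w_scale (w_bracket a (-1)) \<phi>"
  let ?\<alpha> = "\<lambda>t. Poly_Mapping.lookup (\<phi> (L 0)) (IdxL t)"
  let ?\<beta> = "\<lambda>t. Poly_Mapping.lookup (\<phi> (L 0)) (IdxI t)"
  have fin: "finite {t. ?\<alpha> t \<noteq> 0}" "finite {t. ?\<beta> t \<noteq> 0}"
    by (rule finite_lookup_inj; simp add: inj_def)+
  have "\<phi> (L m) = (\<Sum>t\<in>{t. ?\<alpha> t \<noteq> 0}. w_scale (?\<alpha> t) (L (m + t)))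
      + (\<Sum>t\<in>{t. ?\<beta> t \<noteq> 0}. w_scale (?\<beta> t) (I (m + t)))"
    and "\<phi> (I m) = (\<Sum>t\<in>{t. ?\<alpha> t \<noteq> 0}. w_scale (?\<alpha> t) (I (m + t)))" for m
    using half_derivation_L_coeff_L[OF \<phi>, of m] half_derivation_I_coeff_L[OF \<phi>]
      half_derivation_shifts[OF \<phi>, of m]
    by (auto intro!: poly_mapping_w_eqI simp: lookup_add fin)
  with fin show "\<exists>\<alpha> \<beta> :: int \<Rightarrow> complex.
      finite {t. \<alpha> t \<noteq> 0} \<and> finite {t. \<beta> t \<noteq> 0} \<and>
      (\<forall>m. \<phi> (L m) = (\<Sum>t\<in>{t. \<alpha> t \<noteq> 0}. w_scale (\<alpha> t) (L (m + t)))
          + (\<Sum>t\<in>{t. \<beta> t \<noteq> 0}. w_scale (\<beta> t) (I (m + t))) \<and>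
        \<phi> (I m) = (\<Sum>t\<in>{t. \<alpha> t \<noteq> 0}. w_scale (\<alpha> t) (I (m + t))))"
    by (intro exI[of _ ?\<alpha>] exI[of _ ?\<beta>] conjI allI)
qed

end
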